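(* Let $k\ge 1$ be an integer, and write the polynomial $A(k,1)$ in the variable $x$ (defined in the context) as $A(k,1)=C_kx^{k+1}+s_kx^k+g(x)$, where $C_k=\frac{1}{k+1}\binom{2k}{k}$ is the $k$-th Catalan number and $g$ is a polynomial of degree at most $k-1$. Then $$s_k=-\left(2^{2k-1}-\binom{2k-1}{k}\right).$$
   Context: For an integer $m\ge 0$ let $(x)_m=x(x-1)\cdots(x-m+1)$, with $(x)_0=1$. For integers $k\ge 2$, $l\ge 1$, $A(k,l)$ is the polynomial in $x$ given by the determinant of the $k\times k$ matrix $B=(B_{ij})_{1\le i,j\le k}$ whose entries in the first $k-1$ columns ($1\le j\le k-1$) are $B_{ij}=\frac{(-1)^{i-j}(x)_{2(i-j)}}{2^{i-j}(i-j)!}$ if $i\ge j$ and $B_{ij}=0$ if $i<j$, and whose last column is $B_{ik}=\frac{(-1)^{i-1}(x)_{l+2(i-1)+1}}{2^{i-1}(i-1)!}$ for $1\le i\le k$. Also $A(1,l)=(x)_{l+1}$ for $l\ge 1$. For $k\ge 1$, the value of $A(k,1)$ at $x=n$ is $M_n(2k)$, the sum of the $2k$-th powers of the zeros of the $n$-th monic (probabilists') Hermite polynomial $H_n$, where $H_0(x)=1$, $H_1(x)=x$, $H_{n+1}(x)=xH_n(x)-nH_{n-1}(x)$. The polynomial $A(k,1)$ has degree $k+1$ and leading coefficient $C_k$. *)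

theory Defs
  imports Complex_Main "HOL-Computational_Algebra.Polynomial" "Jordan_Normal_Form.Determinant"
begin

text \<open>The falling factorial \<open>(x)\<^sub>m = x (x - 1) \<dots> (x - m + 1)\<close> as a polynomial in \<open>x\<close>.\<close>

definition falling_poly :: "nat \<Rightarrow> real poly" where
  "falling_poly m = (\<Prod>r<m. [:- of_nat r, 1:])"

text \<open>The matrix \<open>B\<close> has rows and columns numbered \<open>1, \<dots>, k\<close> in its entry function, whereas
  \<^const>\<open>mat\<close> numbers them from 0; hence the shift in \<open>B_mat\<close>.\<close>

definition B_entry :: "nat \<Rightarrow> nat \<Rightarrow> nat \<Rightarrow> nat \<Rightarrow> real poly" where
  "B_entry k l i j =
     (if j < k then
        (if i \<ge> j then
           smult ((-1) ^ (i - j) / (2 ^ (i - j) * fact (i - j))) (falling_poly (2 * (i - j)))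
         else 0)
      else
        smult ((-1) ^ (i - 1) / (2 ^ (i - 1) * fact (i - 1)))
          (falling_poly (l + 2 * (i - 1) + 1)))"

definition B_mat :: "nat \<Rightarrow> nat \<Rightarrow> real poly mat" where
  "B_mat k l = mat k k (\<lambda>(i, j). B_entry k l (i + 1) (j + 1))"

text \<open>For \<open>k = 1\<close> the matrix consists of its last column only, so the determinant is
  \<open>(x)\<^bsub>l+1\<^esub>\<close> (lemma \<open>A_poly_1\<close>) and no separate clause is needed.\<close>

definition A_poly :: "nat \<Rightarrow> nat \<Rightarrow> real poly" where
  "A_poly k l = det (B_mat k l)"

lemma poly_falling_poly: "poly (falling_poly m) x = (\<Prod>r<m. x - real r)"
  by (simp add: falling_poly_def poly_prod)

lemma A_poly_1: "A_poly 1 l = falling_poly (l + 1)"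
proof -
  have "B_mat 1 l \<in> carrier_mat 1 1"
    by (simp add: B_mat_def)
  then have "det (B_mat 1 l) = B_mat 1 l $$ (0, 0)"
    by (rule det_single)
  then show ?thesis
    by (simp add: A_poly_def B_mat_def B_entry_def)
qed

end

theory Submission
  imports Defs "HOL-Computational_Algebra.Formal_Power_Series"
begin

text \<open>Let \<open>H(t) = \<Sum>\<^sub>m (-1)\<^sup>m (x)\<^bsub>2m\<^esub> t\<^sup>m / (2\<^sup>m m!)\<close>. By Cramer's rule for a triangular Toeplitz
  system, the determinants \<open>A(k,1)\<close> are the coefficients of \<open>-2 H'/H\<close>. The hypergeometric
  (Hermite) equation for \<open>H\<close> becomes a Riccati equation for this logarithmic derivative, that is,
  \<open>M\<^sub>0 = x\<close> and \<open>M\<^bsub>m+1\<^esub> = (\<Sum>\<^bsub>i+j=m\<^esub> M\<^sub>i M\<^sub>j) - (2m+1) M\<^sub>m\<close> with \<open>M\<^sub>k = A(k,1)\<close>. The two top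
  coefficients of \<open>M\<^sub>k\<close> then satisfy recurrences that are solved with
  \<open>\<Sum>\<^sub>n (2n choose n) z\<^sup>n = (1 - 4z)\<^bsup>-1/2\<^esup>\<close>.\<close>

no_notation vec_index (infixl "$" 100)
unbundle fps_syntax

section \<open>Central binomial coefficients and Catalan numbers\<close>

definition catalan :: "nat \<Rightarrow> real" where
  "catalan n = real ((2 * n) choose n) / (real n + 1)"

definition central_fps :: "real fps" where
  "central_fps = Abs_fps (\<lambda>n. real ((2 * n) choose n))"

definition catalan_fps :: "real fps" where
  "catalan_fps = Abs_fps catalan"

lemma central_binomial_Suc:
  "(real n + 1) * real ((2 * Suc n) choose Suc n) = (4 * real n + 2) * real ((2 * n) choose n)"
proof -
  have "(2 * Suc n) choose Suc n = 2 * ((2 * n + 1) choose n)"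
    using binomial_symmetric[of "Suc n" "2 * n + 1"] by simp
  moreover have "Suc n * ((2 * n + 1) choose n) = (2 * n + 1) * ((2 * n) choose n)"
    using Suc_times_binomial_eq[of "2 * n" n] binomial_symmetric[of "Suc n" "2 * n + 1"]
    by (simp add: mult.commute)
  then have "real (Suc n) * real ((2 * n + 1) choose n) = real (2 * n + 1) * real ((2 * n) choose n)"
    by (metis of_nat_mult)
  ultimately show ?thesis
    by (simp add: algebra_simps)
qed

lemma fps_numeral_mult_nth [simp]:
  fixes F :: "'a :: comm_ring_1 fps"
  shows "(numeral w * F) $ n = numeral w * F $ n"
  by (simp add: numeral_fps_const)

lemma fps_linear_mult_nth:
  fixes F :: "'a :: comm_ring_1 fps"
  shows "((1 - 4 * fps_X) * F) $ n = F $ n - (if n = 0 then 0 else 4 * F $ (n - 1))"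
proof -
  have "(1 - 4 * fps_X) * F = F - 4 * (fps_X * F)"
    by (simp add: algebra_simps)
  then show ?thesis
    by simp
qed

text \<open>Coefficientwise this is the ratio recurrence
  \<open>central_binomial_Suc\<close>.\<close>

lemma central_fps_deriv: "(1 - 4 * fps_X) * fps_deriv central_fps = 2 * central_fps"
proof (rule fps_ext)
  fix n
  have deriv: "fps_deriv central_fps $ n = (4 * real n + 2) * real ((2 * n) choose n)" for n
    using central_binomial_Suc[of n] by (simp add: central_fps_def add.commute del: binomial_Suc_Suc)
  show "((1 - 4 * fps_X) * fps_deriv central_fps) $ n = (2 * central_fps) $ n"
  proof (cases n)
    case 0
    then show ?thesis
      unfolding fps_linear_mult_nth deriv by (simp add: central_fps_def)
  next
    case (Suc m)
    then show ?thesis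
      unfolding fps_linear_mult_nth deriv using central_binomial_Suc[of m]
      by (simp add: central_fps_def algebra_simps del: binomial_Suc_Suc)
  qed
qed

text \<open>The left side has derivative zero by \<open>central_fps_deriv\<close> and constant term
  1. This replaces the closed form of \<open>central_fps\<close> as an inverse square root.\<close>

lemma central_fps_square: "(1 - 4 * fps_X) * central_fps\<^sup>2 = 1"
proof -
  let ?B = central_fps
  have "fps_deriv ((1 - 4 * fps_X) * ?B\<^sup>2)
      = 2 * ?B * ((1 - 4 * fps_X) * fps_deriv ?B - 2 * ?B)"
    by (simp add: power2_eq_square algebra_simps)
  then have "fps_deriv ((1 - 4 * fps_X) * ?B\<^sup>2) = fps_deriv 1"
    by (simp add: central_fps_deriv)
  then show ?thesis
    by (subst (asm) fps_deriv_eq_iff)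
      (simp add: central_fps_def power2_eq_square)
qed

lemma fps_deriv_X_catalan_fps: "fps_deriv (fps_X * catalan_fps) = central_fps"
proof (rule fps_ext)
  fix n
  have "real n + 1 \<noteq> 0"
    by linarith
  then show "fps_deriv (fps_X * catalan_fps) $ n = central_fps $ n"
    by (simp add: central_fps_def catalan_fps_def catalan_def field_simps del: fps_deriv_mult)
qed

text \<open>Both sides have derivative \<open>- 2 * central_fps\<close> and constant term 1; each is
  the square root of \<open>1 - 4 * fps_X\<close>.\<close>

lemma catalan_fps_central: "1 - 2 * fps_X * catalan_fps = (1 - 4 * fps_X) * central_fps"
proof -
  have "fps_deriv (1 - 2 * (fps_X * catalan_fps)) = - 2 * central_fps"
    by (simp add: algebra_simps flip: fps_deriv_X_catalan_fps)
  moreover have "fps_deriv ((1 - 4 * fps_X) * central_fps) = - 2 * central_fps"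
    using central_fps_deriv by (simp add: algebra_simps)
  ultimately have "fps_deriv (1 - 2 * (fps_X * catalan_fps)) = fps_deriv ((1 - 4 * fps_X) * central_fps)"
    by simp
  then show ?thesis
    by (subst (asm) fps_deriv_eq_iff) (simp add: central_fps_def mult.assoc)
qed

lemma catalan_fps_times_central: "(1 - 2 * fps_X * catalan_fps) * central_fps = 1"
  unfolding catalan_fps_central using central_fps_square by (simp only: power2_eq_square mult.assoc)

lemma catalan_fps_quadratic: "catalan_fps = 1 + fps_X * catalan_fps\<^sup>2"
proof -
  let ?S = "1 - 2 * fps_X * catalan_fps"
  have "?S\<^sup>2 = ?S * ((1 - 4 * fps_X) * central_fps)"
    by (simp add: power2_eq_square flip: catalan_fps_central)
  also have "\<dots> = (1 - 4 * fps_X) * (?S * central_fps)"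
    by (rule mult.left_commute)
  also have "\<dots> = 1 - 4 * fps_X"
    by (simp only: catalan_fps_times_central mult_1_right)
  finally have "4 * fps_X * (1 + fps_X * catalan_fps\<^sup>2 - catalan_fps) = 0"
    by (simp add: power2_eq_square algebra_simps)
  moreover have "(4 * fps_X :: real fps) $ 1 \<noteq> 0"
    by simp
  then have "4 * fps_X \<noteq> (0 :: real fps)"
    by (metis fps_zero_nth)
  ultimately show ?thesis
    by (simp only: mult_eq_0_iff) (simp add: algebra_simps)
qed

text \<open>Segner's recurrence, read off from the quadratic equation. It will govern the leading
  coefficients.\<close>

lemma catalan_Suc: "catalan (Suc m) = (\<Sum>i\<le>m. catalan i * catalan (m - i))"
proof -
  have "catalan (Suc m) = (1 + fps_X * catalan_fps\<^sup>2) $ Suc m"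
    using catalan_fps_quadratic by (metis catalan_fps_def fps_nth_Abs_fps)
  then show ?thesis
    by (simp add: power2_eq_square fps_mult_nth[of "Abs_fps catalan"] catalan_fps_def atLeast0AtMost)
qed

text \<open>For positive n this is the negative of the claimed s_n. The present form also gives the
  right value 0 at n = 0 and has a simple generating function.\<close>

definition subcatalan :: "nat \<Rightarrow> real" where
  "subcatalan n = (4 ^ n - real ((2 * n) choose n)) / 2"

text \<open>With S = 1 - 2XC for the Catalan series C, B = \<open>central_fps\<close> and 2T = G -
  B, the relations SG = B and SB = 1 give 2ST = B - 1; coefficients of X^(m+1) are then
  compared.\<close>

lemma subcatalan_Suc:
  "subcatalan (Suc m)
    = 2 * (\<Sum>i\<le>m. catalan i * subcatalan (m - i)) + (2 * real m + 1) * catalan m"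
proof -
  define T where "T = Abs_fps subcatalan"
  define G where "G = Abs_fps (\<lambda>n. 4 ^ n :: real)"
  have G: "(1 - 4 * fps_X) * G = 1"
  proof (rule fps_ext)
    show "((1 - 4 * fps_X) * G) $ n = 1 $ n" for n
      by (cases n) (simp_all add: fps_linear_mult_nth G_def)
  qed
  have T: "2 * T = G - central_fps"
    by (rule fps_ext) (simp add: T_def G_def central_fps_def subcatalan_def)
  have "2 * ((1 - 2 * fps_X * catalan_fps) * T) = (1 - 2 * fps_X * catalan_fps) * (G - central_fps)"
    by (simp flip: T)
  also have "\<dots> = (1 - 2 * fps_X * catalan_fps) * G - 1"
    by (simp only: right_diff_distrib catalan_fps_times_central)
  also have "(1 - 2 * fps_X * catalan_fps) * G = (1 - 4 * fps_X) * G * central_fps"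
    by (subst catalan_fps_central) (simp only: mult.assoc mult.commute[of G central_fps])
  finally have "2 * ((1 - 2 * fps_X * catalan_fps) * T) = central_fps - 1"
    by (simp add: G)
  then have "2 * T = 4 * (fps_X * (catalan_fps * T)) + central_fps - 1"
    by (simp add: algebra_simps)
  then have "(2 * T) $ Suc m = (4 * (fps_X * (catalan_fps * T)) + central_fps - 1) $ Suc m"
    by simp
  then have "2 * subcatalan (Suc m)
      = 4 * (\<Sum>i\<le>m. catalan i * subcatalan (m - i)) + real ((2 * Suc m) choose Suc m)"
    by (simp add: fps_mult_nth[of "Abs_fps catalan"] catalan_fps_def T_def central_fps_def
        atLeast0AtMost del: binomial_Suc_Suc)
  moreover have "real ((2 * Suc m) choose Suc m) = 2 * ((2 * real m + 1) * catalan m)"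
    using central_binomial_Suc[of m] by (simp add: catalan_def field_simps)
  ultimately show ?thesis
    by simp
qed

section \<open>The Riccati recurrence\<close>

text \<open>At x = n this is the coefficient of z^(n-2m) in the Hermite polynomial H_n(z).\<close>

definition hermite_coeff :: "nat \<Rightarrow> real poly" where
  "hermite_coeff m = smult ((-1) ^ m / (2 ^ m * fact m)) (falling_poly (2 * m))"

definition hermite_fps :: "real poly fps" where
  "hermite_fps = Abs_fps hermite_coeff"

text \<open>The series -2H'/H; at x = n its coefficient of t^m is the power sum M_n(2m+2). The
  coefficient ring is not a field, but H has constant term 1 and so is invertible.\<close>

definition shifted_moment_fps :: "real poly fps" where
  "shifted_moment_fps = - 2 * fps_deriv hermite_fps * fps_right_inverse hermite_fps 1"

definition moment_fps :: "real poly fps" where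
  "moment_fps = fps_const [:0, 1:] + fps_X * shifted_moment_fps"

lemma falling_poly_Suc: "falling_poly (Suc m) = [:- real m, 1:] * falling_poly m"
  by (simp add: falling_poly_def mult.commute)

lemma hermite_coeff_0: "hermite_coeff 0 = 1"
  by (simp add: hermite_coeff_def falling_poly_def)

text \<open>The factor 2(m+1) cancels against the denominator, leaving the negative of a last-column
  entry of the matrix for l = 1.\<close>

lemma of_nat_times_hermite_coeff:
  "of_nat (2 * Suc m) * hermite_coeff (Suc m)
    = - smult ((-1) ^ m / (2 ^ m * fact m)) (falling_poly (2 * Suc m))"
proof -
  have "real (2 * Suc m) * ((-1) ^ Suc m / (2 ^ Suc m * fact (Suc m))) = - ((-1) ^ m / (2 ^ m * fact m))"
    by (simp only: of_nat_mult power_Suc fact_Suc) (simp del: of_nat_Suc)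
  moreover have "of_nat (2 * Suc m) * hermite_coeff (Suc m)
      = smult (real (2 * Suc m) * ((-1) ^ Suc m / (2 ^ Suc m * fact (Suc m)))) (falling_poly (2 * Suc m))"
  proof -
    have "of_nat n * smult c p = smult (real n * c) p" for n c and p :: "real poly"
      by (simp add: of_nat_poly mult.commute)
    then show ?thesis
      unfolding hermite_coeff_def .
  qed
  ultimately show ?thesis
    by (simp only: smult_minus_left)
qed

lemma hermite_coeff_Suc:
  "of_nat (2 * Suc m) * hermite_coeff (Suc m)
    = - ([:- real (2 * m), 1:] * [:- real (Suc (2 * m)), 1:] * hermite_coeff m)"
proof -
  have "falling_poly (2 * Suc m)
      = [:- real (2 * m), 1:] * [:- real (Suc (2 * m)), 1:] * falling_poly (2 * m)"
    by (simp only: mult_Suc_right add_2_eq_Suc falling_poly_Suc mult.assoc mult.left_commute)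
  then show ?thesis
    unfolding of_nat_times_hermite_coeff by (simp only: hermite_coeff_def mult_smult_right)
qed

lemma shifted_moment_fps_hermite: "shifted_moment_fps * hermite_fps = - 2 * fps_deriv hermite_fps"
proof -
  let ?I = "fps_right_inverse hermite_fps 1"
  have inv: "hermite_fps * ?I = 1"
    by (rule fps_right_inverse) (simp add: hermite_fps_def hermite_coeff_0)
  have "shifted_moment_fps * hermite_fps = - 2 * fps_deriv hermite_fps * (hermite_fps * ?I)"
    by (simp only: shifted_moment_fps_def mult.assoc mult.commute[of ?I hermite_fps])
  then show ?thesis
    by (simp only: inv mult_1_right)
qed

lemma hermite_fps_ode:
  defines "x \<equiv> fps_const [:0, 1:] :: real poly fps"
  shows "2 * fps_deriv hermite_fps + x * (x - 1) * hermite_fps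
    + (6 - 4 * x) * (fps_X * fps_deriv hermite_fps)
    + 4 * (fps_X * (fps_X * fps_deriv (fps_deriv hermite_fps))) = 0" (is "?L = 0")
proof (rule fps_ext)
  fix n
  let ?x = "[:0, 1:] :: real poly"
  have x: "x * (x - 1) = fps_const (?x * (?x - 1))" "6 - 4 * x = fps_const (6 - 4 * ?x)"
    by (simp_all add: x_def numeral_fps_const flip: fps_const_1_eq_1)
  have "?L $ n = of_nat (2 * Suc n) * hermite_coeff (Suc n)
     + (?x * (?x - 1) + (6 - 4 * ?x) * of_nat n + 4 * of_nat n * (of_nat n - 1)) * hermite_coeff n"
    unfolding x by (cases n; cases "n - 1")
      (simp_all add: numeral_fps_const hermite_fps_def algebra_simps)
  \<comment> \<open>The quadratic factors as (x - 2n)(x - 2n - 1), the ratio in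
    \<open>hermite_coeff_Suc\<close>.\<close>
  also have "?x * (?x - 1) + (6 - 4 * ?x) * of_nat n + 4 * of_nat n * (of_nat n - 1)
      = [:- real (2 * n), 1:] * [:- real (Suc (2 * n)), 1:]"
    by (simp add: of_nat_poly numeral_poly one_pCons algebra_simps)
  finally show "?L $ n = 0 $ n"
    by (simp only: hermite_coeff_Suc) simp
qed

text \<open>Division-free form of substituting P = -2D/H and Q = x + tP into the equation for H;
  \<open>D\<close>, \<open>E\<close> and \<open>Q'\<close> stand for H', H'' and the derivative of
  Q.\<close>

lemma riccati_identity:
  fixes P Q Q' D E H x t :: "'a :: comm_ring_1"
  assumes PH: "P * H = - 2 * D"
    and QH: "Q * H = x * H - 2 * t * D"
    and Q'H: "Q' * H + Q * D = x * D - 2 * D - 2 * t * E"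
    and ode: "2 * D + x * (x - 1) * H + (6 - 4 * x) * (t * D) + 4 * (t * (t * E)) = 0"
  shows "H * H * (P - Q\<^sup>2 + Q + 2 * t * Q') = 0"
proof -
  \<comment> \<open>Regrouped so that P, Q and \<open>Q'\<close> occur only in the combinations
    given by the hypotheses.\<close>
  have "H * H * (P - Q\<^sup>2 + Q + 2 * t * Q')
      = H * (P * H) - (Q * H)\<^sup>2 + H * (Q * H) + 2 * t * (H * (Q' * H + Q * D) - D * (Q * H))"
    by (simp add: algebra_simps power2_eq_square)
  also have "\<dots> = - H * (2 * D + x * (x - 1) * H + (6 - 4 * x) * (t * D) + 4 * (t * (t * E)))"
    unfolding PH QH Q'H by (simp add: algebra_simps power2_eq_square)
  finally show ?thesis
    using ode by simp
qed

lemma moment_fps_riccati: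
  "shifted_moment_fps = moment_fps\<^sup>2 - moment_fps - 2 * fps_X * fps_deriv moment_fps"
proof -
  let ?H = hermite_fps and ?P = shifted_moment_fps and ?Q = moment_fps
  let ?x = "fps_const [:0, 1:] :: real poly fps"
  define D where "D = fps_deriv ?H"
  define E where "E = fps_deriv D"
  define Q' where "Q' = fps_deriv ?Q"
  have PH: "?P * ?H = - 2 * D"
    using shifted_moment_fps_hermite by (simp add: D_def)
  have QH: "?Q * ?H = ?x * ?H - 2 * fps_X * D"
    using PH by (simp add: moment_fps_def algebra_simps)
  have "fps_deriv (?Q * ?H) = fps_deriv (?x * ?H - 2 * fps_X * D)"
    by (simp only: QH)
  then have Q'H: "Q' * ?H + ?Q * D = ?x * D - 2 * D - 2 * fps_X * E"
    by (simp add: Q'_def E_def algebra_simps flip: D_def)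
  have ode: "2 * D + ?x * (?x - 1) * ?H + (6 - 4 * ?x) * (fps_X * D) + 4 * (fps_X * (fps_X * E)) = 0"
    using hermite_fps_ode by (simp add: D_def E_def)
  have "?H * ?H * (?P - ?Q\<^sup>2 + ?Q + 2 * fps_X * Q') = 0"
    using riccati_identity[OF PH QH Q'H ode] .
  \<comment> \<open>Power series over real polynomials form an integral domain, so the square of H
    cancels.\<close>
  moreover have "?H \<noteq> 0"
    by (metis fps_nth_Abs_fps fps_zero_nth hermite_coeff_0 hermite_fps_def zero_neq_one)
  ultimately have "?P - ?Q\<^sup>2 + ?Q + 2 * fps_X * Q' = 0"
    by simp
  then show ?thesis
    by (simp add: Q'_def algebra_simps)
qed

lemma moment_fps_0: "moment_fps $ 0 = [:0, 1:]"
  by (simp add: moment_fps_def)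

lemma moment_fps_Suc: "moment_fps $ Suc m = shifted_moment_fps $ m"
  by (simp add: moment_fps_def)

text \<open>Coefficient of X^m in the Riccati equation: X d/dX contributes 2m and the linear term
  1.\<close>

lemma moment_fps_rec:
  "moment_fps $ Suc m
    = (\<Sum>i\<le>m. moment_fps $ i * moment_fps $ (m - i)) - of_nat (2 * m + 1) * moment_fps $ m"
proof -
  have "(2 * fps_X * fps_deriv moment_fps) $ m = of_nat (2 * m) * moment_fps $ m"
    by (cases m) (simp_all add: numeral_fps_const mult.assoc)
  then have "shifted_moment_fps $ m
      = (moment_fps\<^sup>2) $ m - moment_fps $ m - of_nat (2 * m) * moment_fps $ m"
    by (subst moment_fps_riccati) simp
  then show ?thesis
    by (simp add: moment_fps_Suc power2_eq_square fps_mult_nth atLeast0AtMost algebra_simps)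
qed

section \<open>The determinant\<close>

text \<open>Cramer's rule as a factorization: \<open>T\<close> is unit lower triangular Toeplitz,
  and \<open>U\<close> is the identity with its last column replaced by the solution vector.\<close>

lemma A_poly_eq_moment: "A_poly (Suc m) 1 = moment_fps $ Suc m"
proof -
  let ?k = "Suc m" and ?P = shifted_moment_fps
  define T where "T = mat ?k ?k (\<lambda>(i, j). if j \<le> i then hermite_coeff (i - j) else 0)"
  define U where "U = mat ?k ?k (\<lambda>(i, j). if j = m then ?P $ i else if i = j then 1 else 0)"
  have T: "T \<in> carrier_mat ?k ?k" and U: "U \<in> carrier_mat ?k ?k"
    by (simp_all add: T_def U_def)
  \<comment> \<open>The triangular system solved by the coefficients of P is PH = -2H', read
    coefficientwise.\<close>
  have col: "(\<Sum>r<?k. (if r \<le> i then hermite_coeff (i - r) else 0) * ?P $ r) = B_entry ?k 1 (Suc i) ?k"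
    if "i < ?k" for i
  proof -
    have "(\<Sum>r<?k. (if r \<le> i then hermite_coeff (i - r) else 0) * ?P $ r)
        = (\<Sum>r\<le>i. ?P $ r * hermite_coeff (i - r))"
      using that by (intro sum.mono_neutral_cong_right) auto
    also have "\<dots> = (?P * hermite_fps) $ i"
      by (simp add: fps_mult_nth hermite_fps_def atLeast0AtMost)
    also have "\<dots> = - (of_nat (2 * Suc i) * hermite_coeff (Suc i))"
      unfolding shifted_moment_fps_hermite
      by (simp add: numeral_fps_const hermite_fps_def algebra_simps)
    also have "\<dots> = B_entry ?k 1 (Suc i) ?k"
      unfolding of_nat_times_hermite_coeff by (simp add: B_entry_def)
    finally show ?thesis .
  qed
  have "B_mat ?k 1 = T * U"
  proof (rule eq_matI)
    fix i j assume "i < dim_row (T * U)" "j < dim_col (T * U)"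
    then have ij: "i < ?k" "j < ?k"
      by (simp_all add: T_def U_def)
    have TU: "(T * U) $$ (i, j) = (\<Sum>r<?k. (if r \<le> i then hermite_coeff (i - r) else 0) *
        (if j = m then ?P $ r else if r = j then 1 else 0))"
      using ij by (simp add: T_def U_def scalar_prod_def atLeast0LessThan del: sum.lessThan_Suc)
    show "B_mat ?k 1 $$ (i, j) = (T * U) $$ (i, j)"
    proof (cases "j = m")
      case True
      then show ?thesis
        using ij col[OF ij(1)] unfolding TU by (simp add: B_mat_def del: sum.lessThan_Suc)
    next
      case False
      then have "(T * U) $$ (i, j) = (\<Sum>r<?k. if r = j then (if j \<le> i then hermite_coeff (i - j) else 0) else 0)"
        unfolding TU by (intro sum.cong) auto
      also have "\<dots> = (if j \<le> i then hermite_coeff (i - j) else 0)"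
        using ij by (simp del: sum.lessThan_Suc)
      finally show ?thesis
        using ij False by (auto simp: B_mat_def B_entry_def hermite_coeff_def)
    qed
  qed (simp_all add: B_mat_def T_def U_def)
  then have "A_poly ?k 1 = det T * det U"
    by (simp add: A_poly_def det_mult[OF T U])
  moreover have "det T = 1"
  proof -
    have "det T = prod_list (diag_mat T)"
      by (rule det_lower_triangular[OF _ T]) (simp add: T_def)
    also have "diag_mat T = replicate ?k 1"
      by (auto simp: diag_mat_def T_def hermite_coeff_0 intro!: nth_equalityI simp del: upt_Suc replicate_Suc)
    finally show ?thesis
      by simp
  qed
  moreover have "det U = ?P $ m"
  proof -
    have "upper_triangular U"
      by (auto simp: U_def)
    then have "det U = prod_list (diag_mat U)"
      by (rule det_upper_triangular[OF _ U])
    also have "diag_mat U = replicate m 1 @ [?P $ m]"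
      by (auto simp: diag_mat_def U_def nth_append intro!: nth_equalityI)
    finally show ?thesis
      by simp
  qed
  ultimately show ?thesis
    by (simp add: moment_fps_Suc)
qed

section \<open>The two top coefficients\<close>

lemma coeff_mult_top:
  fixes p q :: "'a :: comm_semiring_0 poly"
  assumes "degree p \<le> a" "degree q \<le> b"
  shows "coeff (p * q) (a + b) = coeff p a * coeff q b"
proof -
  have "coeff p i * coeff q (a + b - i) = (if i = a then coeff p a * coeff q b else 0)"
    if "i \<le> a + b" for i
    using assms that by (cases i a rule: linorder_cases) (auto simp: coeff_eq_0)
  then show ?thesis
    by (simp add: coeff_mult)
qed

text \<open>Among the index pairs with sum a + b + 1, only (a+1, b) and (a, b+1) respect both degree
  bounds.\<close>

lemma coeff_mult_subtop:
  fixes p q :: "'a :: comm_semiring_0 poly"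
  assumes "degree p \<le> Suc a" "degree q \<le> Suc b"
  shows "coeff (p * q) (Suc (a + b)) = coeff p (Suc a) * coeff q b + coeff p a * coeff q (Suc b)"
proof -
  have "coeff p i * coeff q (Suc (a + b) - i) = (if i = Suc a then coeff p (Suc a) * coeff q b else 0)
      + (if i = a then coeff p a * coeff q (Suc b) else 0)"
    if "i \<le> Suc (a + b)" for i
  proof -
    consider "i < a" | "i = a" | "i = Suc a" | "i > Suc a"
      by linarith
    then show ?thesis
      using assms that by cases (auto simp: coeff_eq_0 Suc_diff_le)
  qed
  then show ?thesis
    by (simp add: coeff_mult sum.distrib del: sum.atMost_Suc)
qed

text \<open>Strong induction along \<open>moment_fps_rec\<close>: the leading coefficients obey
  \<open>catalan_Suc\<close>, the next ones \<open>subcatalan_Suc\<close>.\<close>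

lemma moment_top_coeffs:
  "degree (moment_fps $ k) \<le> Suc k \<and> coeff (moment_fps $ k) (Suc k) = catalan k
    \<and> coeff (moment_fps $ k) k = - subcatalan k"
proof (induction k rule: less_induct)
  case (less k)
  let ?M = "\<lambda>k. moment_fps $ k"
  show ?case
  proof (cases k)
    case 0
    then show ?thesis
      by (simp add: moment_fps_0 catalan_def subcatalan_def)
  next
    case (Suc m)
    have deg: "degree (?M i) \<le> Suc i" and top: "coeff (?M i) (Suc i) = catalan i"
      and sub: "coeff (?M i) i = - subcatalan i" if "i \<le> m" for i
      using less.IH[of i] that Suc by auto
    have degp: "degree (?M i * ?M (m - i)) \<le> Suc (Suc m)" if "i \<le> m" for i
      using deg[OF that] deg[of "m - i"] degree_mult_le[of "?M i" "?M (m - i)"] that by linarith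
    have degm: "degree (of_nat (2 * m + 1) * ?M m) \<le> Suc m"
      unfolding of_nat_poly using deg[of m] by simp
    have "degree (?M (Suc m)) \<le> Suc (Suc m)"
      unfolding moment_fps_rec using degp degm by (intro degree_diff_le degree_sum_le) auto
    moreover have "coeff (?M (Suc m)) (Suc (Suc m)) = catalan (Suc m)"
    proof -
      have "coeff (?M i * ?M (m - i)) (Suc (Suc m)) = catalan i * catalan (m - i)" if "i \<le> m" for i
        using coeff_mult_top[OF deg deg, of i "m - i"] that by (simp add: top)
      \<comment> \<open>The linear term has degree at most m + 1, so it first contributes to the
        second coefficient.\<close>
      moreover have "coeff (of_nat (2 * m + 1) * ?M m) (Suc (Suc m)) = 0"
        using degm by (intro coeff_eq_0) simp
      ultimately show ?thesis
        unfolding moment_fps_rec by (simp add: coeff_sum catalan_Suc)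
    qed
    moreover have "coeff (?M (Suc m)) (Suc m) = - subcatalan (Suc m)"
    proof -
      have "coeff (?M i * ?M (m - i)) (Suc m)
          = - (catalan i * subcatalan (m - i)) - catalan (m - i) * subcatalan i" if "i \<le> m" for i
        using coeff_mult_subtop[OF deg deg, of i "m - i"] that by (simp add: top sub)
      moreover have "coeff (of_nat (2 * m + 1) * ?M m) (Suc m) = (2 * real m + 1) * catalan m"
        unfolding of_nat_poly by (simp add: top)
      \<comment> \<open>Reversal identifies the two cross sums, which yields the factor 2 in
        \<open>subcatalan_Suc\<close>.\<close>
      moreover have "(\<Sum>i\<le>m. catalan (m - i) * subcatalan i) = (\<Sum>i\<le>m. catalan i * subcatalan (m - i))"
        by (rule sum.reindex_bij_witness[of _ "\<lambda>i. m - i" "\<lambda>i. m - i"]) auto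
      ultimately show ?thesis
        unfolding moment_fps_rec subcatalan_Suc
        by (simp add: coeff_sum sum_subtractf sum_negf)
    qed
    ultimately show ?thesis
      using Suc by simp
  qed
qed

theorem proposition2:
  fixes k :: nat
  assumes "k \<ge> 1"
  shows "\<exists>(s :: real) (g :: real poly).
           A_poly k 1 = monom (1 / (real k + 1) * real ((2 * k) choose k)) (k + 1) + monom s k + g
           \<and> degree g \<le> k - 1
           \<and> s = - (2 ^ (2 * k - 1) - real ((2 * k - 1) choose k))"
proof -
  obtain m where k: "k = Suc m"
    using assms by (cases k) auto
  let ?c = "1 / (real k + 1) * real ((2 * k) choose k)"
  let ?s = "- (2 ^ (2 * k - 1) - real ((2 * k - 1) choose k))"
  \<comment> \<open>Taking g as the remainder makes the decomposition trivial; only its degree bound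
    needs proof.\<close>
  let ?g = "A_poly k 1 - monom ?c (k + 1) - monom ?s k"
  have A: "A_poly k 1 = moment_fps $ k"
    by (simp only: k A_poly_eq_moment)
  have c: "?c = catalan k"
    by (simp add: catalan_def)
  have "(2 * k) choose k = 2 * ((2 * k - 1) choose k)"
    using binomial_symmetric[of k "2 * m + 1"] by (simp add: k)
  moreover have "(4 :: real) ^ k = 2 * 2 ^ (2 * k - 1)"
    by (simp add: k power_mult)
  ultimately have s: "?s = - subcatalan k"
    by (simp add: subcatalan_def diff_divide_distrib)
  have "degree ?g \<le> k - 1"
  proof (rule degree_le, intro allI impI)
    fix i assume "k - 1 < i"
    then consider "i = k" | "i = Suc k" | "i > Suc k"
      using k by linarith
    then show "coeff ?g i = 0"
      unfolding A c s using moment_top_coeffs[of k] by cases (auto simp: coeff_eq_0)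
  qed
  then show ?thesis
    by (intro exI[of _ ?s] exI[of _ ?g]) simp
qed

end
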